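(* Let $X$ be a uniformly smooth real Banach space with modulus of uniform smoothness $\tau$, let $D\subseteq X$, and let $A_1,A_2:D\to 2^X$ with $0\in A_iq$ for $i=1,2$ be uniformly accretive at zero, with $\Theta$ a modulus of uniform accretivity at zero for $A_1$. Let $(\alpha_n),(\beta_n)$ be sequences in $[0,1)$ such that $\alpha_n,\beta_n\to0$ with joint rate of convergence $\phi$ and $\sum_{i=0}^\infty\alpha_i=\infty$ with rate of divergence $r$. Suppose that $(x_n),(y_n),(u_n)$ and $(v_n)$ are sequences satisfying, for all $n\in\mathbb{N}$, $x_n,y_n\in D$ and $$\begin{aligned}x_{n+1}&=(1-\alpha_n)x_n+\alpha_nu_n,\qquad u_n\in(I-A_1)y_n,\\ y_n&=(1-\beta_n)x_n+\beta_nv_n,\qquad v_n\in(I-A_2)x_n.\end{aligned}$$ Finally, suppose that $K_0,K_1\in(0,\infty)$ satisfy $\|w\|<K_0$ for all $w\in R(I-A_i)$ for $i=1,2$ and $\|x_0-q\|<K_1$. Then $\|x_n-q\|\to0$ as $n\to\infty$ with rate of convergence $$\Phi_{\Theta,\tau,\phi,r,K_0,K_1}(\varepsilon):=r\left(\phi\left(\frac{1}{6K}\min\left\{\frac{\varepsilon}{2},\frac{3\Theta_K(\varepsilon/2)}{32K},\omega_\tau\left(K,\frac{\Theta_K(\varepsilon/2)}{16K}\right)\right\}\right),\frac{K^2}{\Theta_K(\varepsilon/2)}\right)+1$$ for $K:=2K_0+K_1$, where $\omega_\tau:(0,\infty)\times(0,\infty)\to(0,\infty)$ is defined by $$\omega_\tau(d,\varepsilon):=\frac{\varepsilon^2}{12d}\cdot\tau\left(\frac{\varepsilon}{2d}\right),\qquad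 \varepsilon\in(0,2],\ d\geq1,$$ with $\omega_\tau(d,\varepsilon):=\omega_\tau(1,\varepsilon)$ for $d<1$ and $\omega_\tau(d,\varepsilon):=\omega_\tau(d,2)$ for $\varepsilon>2$.
   Context: $\mathbb{N}=\{0,1,2,\ldots\}$. $X$ is a real Banach space with dual $X^\ast$; the normalized duality mapping $J:X\to 2^{X^\ast}$ is $J(x):=\{j\in X^\ast : \langle x,j\rangle=\|x\|^2=\|j\|^2\}$. $X$ is uniformly smooth if for all $\varepsilon>0$ there exists $\delta>0$ such that $$(\ast\ast)\quad\forall x,y\in X\ \big(\|x\|=1\wedge\|y\|\leq\delta\to\|x+y\|+\|x-y\|\leq2+\varepsilon\|y\|\big).$$ A function $\tau:(0,\infty)\to(0,\infty)$ such that $\delta=\tau(\varepsilon)$ satisfies $(\ast\ast)$ for all $\varepsilon>0$ is called a modulus of uniform smoothness for $X$. An operator on $X$ is a mapping $A:X\to 2^X$, with domain $D(A):=\{x\in X: Ax\neq\emptyset\}$ and range $R(A):=\{y\in X:\exists x\in X\,(y\in Ax)\}$; writing $A:D\to2^X$ means $D(A)=D$; $(x,u)\in A$ means $u\in Ax$. $(I-A)x=\{x-u: u\in Ax\}$. $A$ is accretive if for all $u\in Ax$ and $v\in Ay$ there exists $j\in J(x-y)$ with $\langle u-v,j\rangle\geq 0$. An accretive operator $A:D(A)\to 2^X$ with $0\in Aq$ is uniformly accretive at zero if for all $\varepsilon,K>0$ there exists $\delta>0$ such that $$(\ast)\quad \forall (x,u)\in A\ \big(\|x-q\|\in[\varepsilon,K]\to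 \exists j\in J(x-q)\ (\langle u,j\rangle\geq\delta)\big).$$ A function $\Theta_{(\cdot)}(\cdot):(0,\infty)\times(0,\infty)\to(0,\infty)$ such that $\delta:=\Theta_K(\varepsilon)$ satisfies $(\ast)$ for all $\varepsilon,K>0$ is called a modulus of uniform accretivity at zero for $A$. A rate of convergence for a sequence of nonnegative reals $a_n\to 0$ is a function $\phi:(0,\infty)\to\mathbb{N}$ with $\forall\varepsilon>0\ \forall n\geq\phi(\varepsilon)\ (a_n\leq\varepsilon)$. A joint rate of convergence for $\alpha_n,\beta_n\to0$ is a function which is a rate of convergence for both sequences. A rate of divergence for $\sum_{i=0}^\infty\alpha_i=\infty$ (with $\alpha_i\ge 0$) is a function $r:\mathbb{N}\times(0,\infty)\to\mathbb{N}$ with $\sum_{i=N}^{r(N,x)}\alpha_i\geq x$ for all $N\in\mathbb{N}$, $x>0$, where $\sum_{i=N}^m\alpha_i=0$ if $m<N$. *)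

theory Defs
  imports "HOL-Analysis.Analysis"
begin

text \<open>
  Functions on the open half-line \<open>(0,\<infinity>)\<close> are total functions on \<open>real\<close>; only their values
  at positive arguments are constrained or used. The dual space of \<open>'a\<close> is the type
  \<open>'a \<Rightarrow>\<^sub>L real\<close> of bounded linear functionals with the operator norm.
\<close>

definition duality_map :: "'a::real_normed_vector \<Rightarrow> ('a \<Rightarrow>\<^sub>L real) set" where
  "duality_map x = {j. blinfun_apply j x = (norm x)\<^sup>2 \<and> (norm x)\<^sup>2 = (norm j)\<^sup>2}"

definition smoothness_cond :: "'a::real_normed_vector itself \<Rightarrow> real \<Rightarrow> real \<Rightarrow> bool" where
  "smoothness_cond _ \<epsilon> \<delta> \<longleftrightarrow>
     (\<forall>x y :: 'a. norm x = 1 \<and> norm y \<le> \<delta> \<longrightarrow>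
        norm (x + y) + norm (x - y) \<le> 2 + \<epsilon> * norm y)"

definition uniformly_smooth :: "'a::real_normed_vector itself \<Rightarrow> bool" where
  "uniformly_smooth X \<longleftrightarrow> (\<forall>\<epsilon>>0. \<exists>\<delta>>0. smoothness_cond X \<epsilon> \<delta>)"

definition modulus_of_uniform_smoothness ::
    "'a::real_normed_vector itself \<Rightarrow> (real \<Rightarrow> real) \<Rightarrow> bool" where
  "modulus_of_uniform_smoothness X \<tau> \<longleftrightarrow> (\<forall>\<epsilon>>0. \<tau> \<epsilon> > 0 \<and> smoothness_cond X \<epsilon> (\<tau> \<epsilon>))"

text \<open>A set-valued operator is a map \<open>A :: 'a \<Rightarrow> 'a set\<close>; \<open>(x,u) \<in> A\<close> is rendered \<open>u \<in> A x\<close>.\<close>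

definition op_dom :: "('a \<Rightarrow> 'a set) \<Rightarrow> 'a set" where
  "op_dom A = {x. A x \<noteq> {}}"

definition op_range :: "('a \<Rightarrow> 'a set) \<Rightarrow> 'a set" where
  "op_range A = {y. \<exists>x. y \<in> A x}"

definition id_minus :: "('a::real_normed_vector \<Rightarrow> 'a set) \<Rightarrow> 'a \<Rightarrow> 'a set" where
  "id_minus A x = {x - u | u. u \<in> A x}"

definition accretive :: "('a::real_normed_vector \<Rightarrow> 'a set) \<Rightarrow> bool" where
  "accretive A \<longleftrightarrow>
     (\<forall>x y. \<forall>u\<in>A x. \<forall>v\<in>A y. \<exists>j\<in>duality_map (x - y). blinfun_apply j (u - v) \<ge> 0)"

definition uniform_accretivity_cond ::
    "('a::real_normed_vector \<Rightarrow> 'a set) \<Rightarrow> 'a \<Rightarrow> real \<Rightarrow> real \<Rightarrow> real \<Rightarrow> bool" where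
  "uniform_accretivity_cond A q \<epsilon> K \<delta> \<longleftrightarrow>
     (\<forall>x. \<forall>u\<in>A x. norm (x - q) \<in> {\<epsilon>..K} \<longrightarrow>
        (\<exists>j\<in>duality_map (x - q). blinfun_apply j u \<ge> \<delta>))"

definition uniformly_accretive_at_zero :: "('a::real_normed_vector \<Rightarrow> 'a set) \<Rightarrow> 'a \<Rightarrow> bool" where
  "uniformly_accretive_at_zero A q \<longleftrightarrow>
     accretive A \<and> 0 \<in> A q \<and>
     (\<forall>\<epsilon>>0. \<forall>K>0. \<exists>\<delta>>0. uniform_accretivity_cond A q \<epsilon> K \<delta>)"

text \<open>\<open>\<Theta> K \<epsilon>\<close> stands for \<open>\<Theta>\<^sub>K(\<epsilon>)\<close>.\<close>

definition modulus_of_uniform_accretivity_at_zero ::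
    "('a::real_normed_vector \<Rightarrow> 'a set) \<Rightarrow> 'a \<Rightarrow> (real \<Rightarrow> real \<Rightarrow> real) \<Rightarrow> bool" where
  "modulus_of_uniform_accretivity_at_zero A q \<Theta> \<longleftrightarrow>
     (\<forall>\<epsilon>>0. \<forall>K>0. \<Theta> K \<epsilon> > 0 \<and> uniform_accretivity_cond A q \<epsilon> K (\<Theta> K \<epsilon>))"

definition rate_of_convergence :: "(nat \<Rightarrow> real) \<Rightarrow> (real \<Rightarrow> nat) \<Rightarrow> bool" where
  "rate_of_convergence a \<phi> \<longleftrightarrow> (\<forall>\<epsilon>>0. \<forall>n\<ge>\<phi> \<epsilon>. a n \<le> \<epsilon>)"

definition rate_of_divergence :: "(nat \<Rightarrow> real) \<Rightarrow> (nat \<Rightarrow> real \<Rightarrow> nat) \<Rightarrow> bool" where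
  "rate_of_divergence a r \<longleftrightarrow> (\<forall>N. \<forall>x>0. (\<Sum>i=N..r N x. a i) \<ge> x)"

text \<open>
  The formula \<open>\<epsilon>\<^sup>2 / (12 d) \<cdot> \<tau>(\<epsilon> / (2 d))\<close> for \<open>d \<ge> 1\<close> and \<open>\<epsilon> \<in> (0,2]\<close>, extended by
  \<open>\<omega>(d,\<epsilon>) = \<omega>(1,\<epsilon>)\<close> for \<open>d < 1\<close> and \<open>\<omega>(d,\<epsilon>) = \<omega>(d,2)\<close> for \<open>\<epsilon> > 2\<close>; the two
  extensions amount to truncating the arguments.
\<close>

definition omega :: "(real \<Rightarrow> real) \<Rightarrow> real \<Rightarrow> real \<Rightarrow> real" where
  "omega \<tau> d \<epsilon> =
     (let d' = max d 1; \<epsilon>' = min \<epsilon> 2 in \<epsilon>'\<^sup>2 / (12 * d') * \<tau> (\<epsilon>' / (2 * d')))"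

definition Phi ::
    "(real \<Rightarrow> real \<Rightarrow> real) \<Rightarrow> (real \<Rightarrow> real) \<Rightarrow> (real \<Rightarrow> nat) \<Rightarrow> (nat \<Rightarrow> real \<Rightarrow> nat)
      \<Rightarrow> real \<Rightarrow> real \<Rightarrow> real \<Rightarrow> nat" where
  "Phi \<Theta> \<tau> \<phi> r K\<^sub>0 K\<^sub>1 \<epsilon> =
     (let K = 2 * K\<^sub>0 + K\<^sub>1 in
        r (\<phi> (1 / (6 * K) *
               min (\<epsilon> / 2) (min (3 * \<Theta> K (\<epsilon> / 2) / (32 * K))
                                (omega \<tau> K (\<Theta> K (\<epsilon> / 2) / (16 * K))))))
          (K\<^sup>2 / \<Theta> K (\<epsilon> / 2)) + 1)"

end

theory Submission
  imports Defs
begin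

text \<open>
  The duality mapping is uniformly continuous on bounded sets with modulus \<open>omega \<tau>\<close>; accretivity
  itself supplies the required elements of the duality mapping, so Hahn--Banach is not needed.
  Once the step sizes are small, \<open>x (Suc n)\<close> and \<open>y n\<close> are close. Hence either
  \<open>norm (y n - q) < \<epsilon>/2\<close> and \<open>norm (x (Suc n) - q) \<le> \<epsilon>\<close>, or uniform accretivity at \<open>y n\<close>
  transfers to \<open>x (Suc n)\<close> and the subdifferential inequality makes \<open>norm (x n - q)\<^sup>2\<close> drop
  by at least \<open>\<alpha> n * \<Theta> K (\<epsilon>/2)\<close>. The drops cannot continue beyond a total of \<open>K\<^sup>2\<close>, and the ball
  of radius \<open>\<epsilon>\<close> about \<open>q\<close> is never left again.
\<close>

section \<open>Elements of the normalized duality mapping\<close>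

lemma duality_map_apply: "j \<in> duality_map x \<Longrightarrow> blinfun_apply j x = (norm x)\<^sup>2"
  by (simp add: duality_map_def)

lemma norm_duality_map: "j \<in> duality_map x \<Longrightarrow> norm j = norm x"
  by (simp add: duality_map_def power2_eq_iff_nonneg)

lemma blinfun_apply_le: "blinfun_apply f z \<le> norm f * norm z" for f :: "'a::real_normed_vector \<Rightarrow>\<^sub>L real"
  using norm_blinfun[of f z] by simp

text \<open>By Cauchy-Schwarz for the dual pairing and the arithmetic-geometric mean inequality,
  \<open>2 *\<^sub>R j\<close> is a subgradient of the squared norm at \<open>z\<close>.\<close>

lemma duality_map_subgradient:
  fixes w z :: "'a::real_normed_vector"
  assumes "j \<in> duality_map z"
  shows "(norm z)\<^sup>2 \<le> (norm w)\<^sup>2 + 2 * blinfun_apply j (z - w)"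
proof -
  have "blinfun_apply j w \<le> norm z * norm w"
    using blinfun_apply_le[of j w] norm_duality_map[OF assms] by simp
  moreover have "2 * (norm z * norm w) \<le> (norm z)\<^sup>2 + (norm w)\<^sup>2"
    using sum_squares_bound[of "norm z" "norm w"] by simp
  ultimately show ?thesis
    using duality_map_apply[OF assms] by (simp add: blinfun.diff_right)
qed

section \<open>From uniform smoothness to uniform continuity of the duality mapping\<close>

lemma smoothness_condD:
  fixes x y :: "'a::real_normed_vector"
  assumes "smoothness_cond TYPE('a) \<eta> \<sigma>" "norm x = 1" "norm y \<le> \<sigma>"
  shows "norm (x + y) + norm (x - y) \<le> 2 + \<eta> * norm y"
  using assms unfolding smoothness_cond_def by blast

text \<open>Testing the condition with \<open>\<sigma> *\<^sub>R x\<close> gives 2 \<sigma> \<le> 2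
  + \<sigma>. The unit vector rules out the zero space, where the condition is vacuous. The bound
  later controls \<open>norm (x - y)\<close> itself, not only its quotient by \<sigma>.\<close>

lemma smoothness_modulus_le_2:
  fixes x :: "'a::real_normed_vector"
  assumes "smoothness_cond TYPE('a) \<eta> \<sigma>" "norm x = 1" "0 < \<sigma>" "\<eta> \<le> 1"
  shows "\<sigma> \<le> 2"
proof -
  have "norm (x + \<sigma> *\<^sub>R x) + norm (x - \<sigma> *\<^sub>R x) \<le> 2 + \<eta> * norm (\<sigma> *\<^sub>R x)"
    using assms by (intro smoothness_condD[OF assms(1)]) auto
  moreover have "norm (\<sigma> *\<^sub>R x + \<sigma> *\<^sub>R x) \<le> norm (x + \<sigma> *\<^sub>R x) + norm (x - \<sigma> *\<^sub>R x)"
    using norm_triangle_ineq4[of "x + \<sigma> *\<^sub>R x" "x - \<sigma> *\<^sub>R x"] by (simp add: algebra_simps)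
  moreover have "norm (\<sigma> *\<^sub>R x + \<sigma> *\<^sub>R x) = 2 * \<sigma>"
    using assms by (simp flip: scaleR_add_left)
  moreover have "\<eta> * norm (\<sigma> *\<^sub>R x) \<le> \<sigma>" using assms by simp
  ultimately show ?thesis by linarith
qed

text \<open>For \<open>h\<close> of length \<sigma>, smoothness bounds
  \<open>f (x + h) + g (x - h)\<close> by 2 + \<eta> \<sigma>. The values of \<open>f\<close> and
  \<open>g\<close> at \<open>x\<close> use up at least 2 - \<open>s\<close> of this, so
  \<open>(f - g) h\<close> is at most \<eta> \<sigma> + \<open>s\<close>; dividing by \<sigma> gives
  the claim.\<close>

lemma norming_functionals_close:
  fixes x y :: "'a::real_normed_vector" and f g :: "'a \<Rightarrow>\<^sub>L real"
  assumes smooth: "smoothness_cond TYPE('a) \<eta> \<sigma>" and "0 < \<sigma>" "0 \<le> \<eta>"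
    and x: "norm x = 1" and f: "norm f = 1" "blinfun_apply f x = 1"
    and g: "norm g = 1" "1 - s \<le> blinfun_apply g x" and "0 \<le> s"
  shows "norm (f - g) \<le> \<eta> + s / \<sigma>"
proof (rule norm_blinfun_bound)
  show "0 \<le> \<eta> + s / \<sigma>" using assms by simp
  have *: "blinfun_apply (f - g) w \<le> (\<eta> + s / \<sigma>) * norm w" for w
  proof (cases "w = 0")
    case False
    define h where "h = (\<sigma> / norm w) *\<^sub>R w"
    have h: "norm h = \<sigma>" using False \<open>0 < \<sigma>\<close> by (simp add: h_def)
    have "blinfun_apply f (x + h) + blinfun_apply g (x - h) \<le> norm (x + h) + norm (x - h)"
      using blinfun_apply_le[of f "x + h"] blinfun_apply_le[of g "x - h"] f g by simp
    also have "\<dots> \<le> 2 + \<eta> * \<sigma>"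
      using smoothness_condD[OF smooth x, of h] h by simp
    finally have "blinfun_apply (f - g) h \<le> \<eta> * \<sigma> + s"
      using f g by (simp add: blinfun.add_right blinfun.diff_right blinfun.diff_left)
    also have "blinfun_apply (f - g) h = \<sigma> / norm w * blinfun_apply (f - g) w"
      by (simp add: h_def blinfun.scaleR_right)
    finally show ?thesis using False \<open>0 < \<sigma>\<close> by (simp add: field_simps)
  qed simp
  show "norm (blinfun_apply (f - g) w) \<le> (\<eta> + s / \<sigma>) * norm w" for w
    using *[of w] *[of "- w"] by (simp add: blinfun.minus_right)
qed

text \<open>After normalization, \<open>f\<close> norms the direction of \<open>x\<close>, and
  \<open>g\<close>, which norms that of \<open>y\<close>, misses this by at most
  \<open>t / a\<close>. The first two terms bound the change of direction, the last one the change
  of length.\<close>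

lemma duality_map_dist_le:
  fixes x y :: "'a::real_normed_vector"
  assumes smooth: "smoothness_cond TYPE('a) \<eta> \<sigma>" and "0 < \<sigma>" "0 \<le> \<eta>"
    and j: "j \<in> duality_map x" and l: "l \<in> duality_map y"
    and x: "0 < norm x" "norm x \<le> norm y"
  shows "norm (j - l) \<le> norm x * \<eta> + norm (x - y) / \<sigma> + norm (x - y)"
proof -
  define a where "a = norm x"
  define b where "b = norm y"
  define t where "t = norm (x - y)"
  have ab: "0 < a" "a \<le> b" "b - a \<le> t"
    using x norm_triangle_ineq2[of y x] by (auto simp: a_def b_def t_def norm_minus_commute)
  define f where "f = (1 / a) *\<^sub>R j"
  define g where "g = (1 / b) *\<^sub>R l"
  have nf: "norm f = 1" and ng: "norm g = 1"
    using ab norm_duality_map[OF j] norm_duality_map[OF l] by (auto simp: f_def g_def a_def b_def)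
  have fx: "blinfun_apply f ((1 / a) *\<^sub>R x) = 1"
    using ab duality_map_apply[OF j]
    by (simp add: f_def a_def blinfun.scaleR_left blinfun.scaleR_right power2_eq_square)
  have "blinfun_apply g y = b"
    using ab duality_map_apply[OF l] by (simp add: g_def b_def blinfun.scaleR_left power2_eq_square)
  moreover have "blinfun_apply g (y - x) \<le> t"
    using blinfun_apply_le[of g "y - x"] ng by (simp add: t_def norm_minus_commute)
  ultimately have "a - t \<le> blinfun_apply g x" using ab by (simp add: blinfun.diff_right)
  then have "(1 / a) * (a - t) \<le> (1 / a) * blinfun_apply g x"
    using ab by (intro mult_left_mono) auto
  then have gx: "1 - t / a \<le> blinfun_apply g ((1 / a) *\<^sub>R x)"
    using ab by (simp add: blinfun.scaleR_right diff_divide_distrib)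
  have "norm (f - g) \<le> \<eta> + t / a / \<sigma>"
    by (rule norming_functionals_close[OF smooth _ _ _ nf fx ng gx])
      (use assms ab in \<open>auto simp: a_def t_def\<close>)
  then have "a * norm (f - g) \<le> a * (\<eta> + t / a / \<sigma>)"
    using ab by (intro mult_left_mono) auto
  moreover have "a * (\<eta> + t / a / \<sigma>) = a * \<eta> + t / \<sigma>" using ab by (simp add: distrib_left)
  moreover have "j - l = a *\<^sub>R (f - g) - (b - a) *\<^sub>R g"
    using ab by (simp add: f_def g_def scaleR_diff_right diff_divide_distrib scaleR_diff_left)
  then have "norm (j - l) \<le> a * norm (f - g) + (b - a) * norm g"
    using norm_triangle_ineq4[of "a *\<^sub>R (f - g)" "(b - a) *\<^sub>R g"] ab by simp
  ultimately show ?thesis using ab ng by (simp add: a_def t_def)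
qed

text \<open>With \<eta> = \<epsilon> / (2 d) the hypothesis reads
  \<open>norm (x - y) \<le> \<epsilon> * \<eta> / 6 * \<sigma>\<close>, and the three terms of
  \<open>duality_map_dist_le\<close> are at most \<epsilon>/2, \<epsilon>/6 and \<epsilon>/3. The
  last bound uses \<sigma> \<le> 2.\<close>

lemma duality_map_unif_cont_aux:
  fixes x y :: "'a::real_normed_vector"
  assumes mod: "modulus_of_uniform_smoothness TYPE('a) \<tau>"
    and d: "1 \<le> d" and \<epsilon>: "0 < \<epsilon>" "\<epsilon> \<le> 2"
    and j: "j \<in> duality_map x" and l: "l \<in> duality_map y"
    and nx: "norm x \<le> d" and xy: "norm x \<le> norm y" "x \<noteq> 0"
    and t: "norm (x - y) \<le> \<epsilon>\<^sup>2 / (12 * d) * \<tau> (\<epsilon> / (2 * d))"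
  shows "norm (j - l) \<le> \<epsilon>"
proof -
  define \<eta> where "\<eta> = \<epsilon> / (2 * d)"
  have \<eta>: "0 < \<eta>" "\<eta> \<le> 1" "d * \<eta> = \<epsilon> / 2" using d \<epsilon> by (auto simp: \<eta>_def field_simps)
  define \<sigma> where "\<sigma> = \<tau> \<eta>"
  have smooth: "smoothness_cond TYPE('a) \<eta> \<sigma>" and "0 < \<sigma>"
    using mod \<eta> by (auto simp: modulus_of_uniform_smoothness_def \<sigma>_def)
  have "norm ((1 / norm x) *\<^sub>R x) = 1" using xy by simp
  then have "\<sigma> \<le> 2" by (rule smoothness_modulus_le_2[OF smooth]) (use \<open>0 < \<sigma>\<close> \<eta> in auto)
  have t': "norm (x - y) \<le> \<epsilon> * \<eta> / 6 * \<sigma>"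
    using t d by (simp add: \<eta>_def \<sigma>_def power2_eq_square field_simps)
  then have "norm (x - y) / \<sigma> \<le> \<epsilon> * \<eta> / 6" using \<open>0 < \<sigma>\<close> by (simp add: pos_divide_le_eq)
  moreover have "\<epsilon> * \<eta> / 6 \<le> \<epsilon> / 6" using \<epsilon> \<eta> by simp
  moreover have "\<epsilon> * \<eta> / 6 * \<sigma> \<le> \<epsilon> / 6 * 2"
    using \<epsilon> \<eta> \<open>0 < \<sigma>\<close> \<open>\<sigma> \<le> 2\<close> by (intro mult_mono) auto
  moreover have "norm x * \<eta> \<le> d * \<eta>" using nx \<eta> by simp
  moreover have "norm (j - l) \<le> norm x * \<eta> + norm (x - y) / \<sigma> + norm (x - y)"
    by (rule duality_map_dist_le[OF smooth \<open>0 < \<sigma>\<close> _ j l]) (use xy \<eta> in auto)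
  ultimately show ?thesis using t' \<eta>(3) by linarith
qed

lemma duality_map_zero: "j \<in> duality_map 0 \<Longrightarrow> j = 0"
  by (simp add: duality_map_def)

lemma omega_pos:
  assumes "modulus_of_uniform_smoothness TYPE('a::real_normed_vector) \<tau>" "0 < \<epsilon>"
  shows "0 < omega \<tau> d \<epsilon>"
  using assms by (simp add: omega_def Let_def modulus_of_uniform_smoothness_def)

text \<open>Truncating \<open>d\<close> and \<epsilon> as in \<open>omega\<close> and ordering the
  two points by norm leads to the auxiliary lemma, unless the smaller vector is zero.\<close>

lemma duality_map_unif_cont:
  fixes x y :: "'a::real_normed_vector"
  assumes mod: "modulus_of_uniform_smoothness TYPE('a) \<tau>" and \<epsilon>: "0 < \<epsilon>"
    and jl: "j \<in> duality_map x" "l \<in> duality_map y"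
    and nxy: "norm x \<le> d" "norm y \<le> d"
    and t: "norm (x - y) \<le> omega \<tau> d \<epsilon>"
  shows "norm (j - l) \<le> \<epsilon>"
proof -
  define d' where "d' = max d 1"
  define e where "e = min \<epsilon> 2"
  have e: "0 < e" "e \<le> 2" "e \<le> \<epsilon>" and d': "1 \<le> d'" "d \<le> d'"
    using \<epsilon> by (auto simp: e_def d'_def)
  have t': "norm (x - y) \<le> e\<^sup>2 / (12 * d') * \<tau> (e / (2 * d'))"
    using t by (simp add: omega_def Let_def e_def d'_def)
  have "norm (j - l) \<le> e"
    if j: "j \<in> duality_map x" and l: "l \<in> duality_map y"
      and le: "norm x \<le> norm y" "norm y \<le> d"
      and t: "norm (x - y) \<le> e\<^sup>2 / (12 * d') * \<tau> (e / (2 * d'))" for x y :: 'a and j l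
  proof (cases "x = 0")
    case False
    show ?thesis
      by (rule duality_map_unif_cont_aux[OF mod d'(1) e(1,2) j l _ le(1) False t])
        (use le d' in simp)
  next
    \<comment> \<open>Zero cannot be normalized, but here \<open>j = 0\<close> and
      \<open>norm l = norm y\<close>, so only \<open>norm y\<close> has to be small.\<close>
    case x: True
    show ?thesis
    proof (cases "y = 0")
      case True
      then show ?thesis using x j l e by (auto dest!: duality_map_zero)
    next
      case False
      define \<eta> where "\<eta> = e / (2 * d')"
      have \<eta>: "0 < \<eta>" "\<eta> \<le> 1" using d' e by (auto simp: \<eta>_def field_simps)
      have smooth: "smoothness_cond TYPE('a) \<eta> (\<tau> \<eta>)" and "0 < \<tau> \<eta>"
        using mod \<eta> by (auto simp: modulus_of_uniform_smoothness_def)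
      have "norm ((1 / norm y) *\<^sub>R y) = 1" using False by simp
      then have "\<tau> \<eta> \<le> 2"
        by (rule smoothness_modulus_le_2[OF smooth]) (use \<open>0 < \<tau> \<eta>\<close> \<eta> in auto)
      have "norm y \<le> e * \<eta> / 6 * \<tau> \<eta>"
        using t x d' by (simp add: \<eta>_def power2_eq_square field_simps)
      also have "\<dots> \<le> e / 6 * 2"
        using e \<eta> \<open>0 < \<tau> \<eta>\<close> \<open>\<tau> \<eta> \<le> 2\<close> by (intro mult_mono) auto
      finally show ?thesis
        using x j l e norm_duality_map[OF l] by (auto dest!: duality_map_zero)
    qed
  qed
  note * = this
  have "norm (j - l) \<le> e"
  proof (cases "norm x \<le> norm y")
    case True
    then show ?thesis using *[OF jl] nxy t' by simp
  next
    case False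
    then show ?thesis using *[OF jl(2,1)] nxy t' by (simp add: norm_minus_commute)
  qed
  then show ?thesis using e by simp
qed

section \<open>Convexity, one descent step, and the resulting rate\<close>

lemma norm_convex_comb_less:
  fixes a b :: "'a::real_normed_vector"
  assumes "0 \<le> t" "t < 1" "norm a < K" "norm b < K"
  shows "norm ((1 - t) *\<^sub>R a + t *\<^sub>R b) < K"
proof -
  have "norm ((1 - t) *\<^sub>R a + t *\<^sub>R b) \<le> (1 - t) * norm a + t * norm b"
    using norm_triangle_ineq[of "(1 - t) *\<^sub>R a" "t *\<^sub>R b"] assms by simp
  also have "\<dots> < (1 - t) * K + t * K"
    using assms by (intro add_less_le_mono mult_strict_left_mono mult_left_mono) auto
  finally show ?thesis by (simp add: algebra_simps)
qed

text \<open>Apply accretivity to any element of \<open>A x\<close> and to 0 in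
  \<open>A q\<close>.\<close>

lemma accretive_duality_map_nonempty:
  assumes "accretive A" "0 \<in> A q" "x \<in> op_dom A"
  obtains j where "j \<in> duality_map (x - q)"
  using assms by (fastforce simp: accretive_def op_dom_def)

text \<open>In the application \<open>p\<close>, \<open>p'\<close> and \<open>w\<close> are
  \<open>x n - q\<close>, \<open>x (Suc n) - q\<close> and \<open>y n - q\<close>, with
  \<open>a\<close> in \<open>A\<^sub>1 (y n)\<close> and \<open>t = \<alpha> n\<close>. The
  subgradient is taken at the new point \<open>p'\<close>, whereas accretivity is known at
  \<open>w\<close>; closeness of \<open>p'\<close> and \<open>w\<close> allows \<open>l\<close> to
  be replaced by \<open>j\<close>.\<close>

lemma descent_step:
  fixes p p' w a :: "'a::real_normed_vector"
  assumes mod: "modulus_of_uniform_smoothness TYPE('a) \<tau>"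
    and j: "j \<in> duality_map p'" and l: "l \<in> duality_map w"
    and acc: "\<theta> \<le> blinfun_apply l a" and \<theta>: "0 < \<theta>"
    and K: "0 < K" "norm p' \<le> K" "norm w \<le> K" "norm a \<le> 2 * K"
    and p': "p' = p + t *\<^sub>R (w - p - a)" and t: "0 \<le> t"
    and wp: "norm (w - p) \<le> \<theta> / (32 * K)"
    and p'w: "norm (p' - w) \<le> omega \<tau> K (\<theta> / (16 * K))"
  shows "(norm p')\<^sup>2 \<le> (norm p)\<^sup>2 - t * \<theta>"
proof -
  have "norm (j - l) \<le> \<theta> / (16 * K)"
    by (rule duality_map_unif_cont[OF mod _ j l _ _ p'w]) (use \<theta> K in auto)
  then have "norm (l - j) * norm a \<le> \<theta> / (16 * K) * (2 * K)"
    using K \<theta> by (intro mult_mono) (auto simp: norm_minus_commute)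
  also have "\<dots> = \<theta> / 8" using K by simp
  finally have "blinfun_apply (l - j) a \<le> \<theta> / 8"
    using blinfun_apply_le[of "l - j" a] by linarith
  then have 1: "7 / 8 * \<theta> \<le> blinfun_apply j a" using acc by (simp add: blinfun.diff_left)
  have "norm j * norm (w - p) \<le> K * (\<theta> / (32 * K))"
    using wp K norm_duality_map[OF j] by (intro mult_mono) auto
  then have 2: "blinfun_apply j (w - p) \<le> \<theta> / 32"
    using blinfun_apply_le[of j "w - p"] K by simp
  \<comment> \<open>The exact balance is 1/32 - 7/8 \<le> -1/2; the factor 2 in the subgradient
    inequality turns \<theta>/2 into \<theta>.\<close>
  have "blinfun_apply j (w - p - a) \<le> - (\<theta> / 2)"
    using 1 2 \<theta> by (simp add: blinfun.diff_right)
  then have "t * blinfun_apply j (w - p - a) \<le> t * - (\<theta> / 2)"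
    using t by (rule mult_left_mono)
  moreover have "blinfun_apply j (p' - p) = t * blinfun_apply j (w - p - a)"
    by (simp add: p' blinfun.scaleR_right)
  ultimately show ?thesis using duality_map_subgradient[OF j, of p] by simp
qed

text \<open>While \<open>a\<close> stays above \<epsilon>, its square loses
  \<open>\<alpha> n * \<theta>\<close> at each step, and the budget \<open>K\<^sup>2\<close> is
  spent by index \<open>M + 1\<close>. Once some value is at most \<epsilon>, either alternative of
  the step preserves this.\<close>

lemma descent_rate:
  fixes a \<alpha> :: "nat \<Rightarrow> real"
  assumes nonneg: "\<And>n. 0 \<le> a n" "\<And>n. 0 \<le> \<alpha> n"
    and step: "\<And>n. N \<le> n \<Longrightarrow> a (Suc n) \<le> \<epsilon> \<or> (a (Suc n))\<^sup>2 \<le> (a n)\<^sup>2 - \<alpha> n * \<theta>"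
    and "0 < \<epsilon>" "0 < \<theta>" "0 < K" "a N \<le> K"
    and r: "K\<^sup>2 / \<theta> \<le> (\<Sum>i=N..M. \<alpha> i)" and n: "M + 1 \<le> n"
  shows "a n \<le> \<epsilon>"
proof -
  \<comment> \<open>For \<open>M < N\<close> the sum would be empty, hence zero, below the positive
    bound \<open>K\<^sup>2 / \<theta>\<close>.\<close>
  have "N \<le> M"
  proof (rule ccontr)
    assume "\<not> N \<le> M"
    then have "K\<^sup>2 / \<theta> \<le> 0" using r by simp
    moreover have "0 < K\<^sup>2 / \<theta>" using assms by simp
    ultimately show False by simp
  qed
  have "\<exists>k. N \<le> k \<and> k \<le> M + 1 \<and> a k \<le> \<epsilon>"
  proof (rule ccontr)
    assume none: "\<not> ?thesis"
    have "(a (Suc m))\<^sup>2 \<le> K\<^sup>2 - (\<Sum>i=N..m. \<alpha> i) * \<theta>" if "N \<le> m" "m \<le> M" for m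
      using that
    proof (induction m rule: dec_induct)
      case base
      have "(a N)\<^sup>2 \<le> K\<^sup>2" using assms by (intro power_mono) auto
      then show ?case using step[of N] none base by fastforce
    next
      case (step m)
      then show ?case using assms(3)[of "Suc m"] none
        by (fastforce simp: algebra_simps)
    qed
    then have "(a (Suc M))\<^sup>2 \<le> K\<^sup>2 - (\<Sum>i=N..M. \<alpha> i) * \<theta>" using \<open>N \<le> M\<close> by simp
    also have "\<dots> \<le> 0" using r \<open>0 < \<theta>\<close> by (simp add: pos_divide_le_eq)
    \<comment> \<open>The drops with indices up to \<open>M\<close> act on the value at
      \<open>Suc M\<close>, which accounts for the \<open>+ 1\<close> in \<open>Phi\<close>.\<close>
    finally have "a (Suc M) = 0" by simp
    then show False using none \<open>N \<le> M\<close> \<open>0 < \<epsilon>\<close> by force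
  qed
  then obtain k where k: "N \<le> k" "k \<le> M + 1" "a k \<le> \<epsilon>" by blast
  from k(2) n have "k \<le> n" by simp
  then show ?thesis
  proof (induction n rule: dec_induct)
    case base
    show ?case by (rule k)
  next
    case (step m)
    have "a (Suc m) \<le> a m" if "(a (Suc m))\<^sup>2 \<le> (a m)\<^sup>2 - \<alpha> m * \<theta>"
    proof (rule power2_le_imp_le)
      have "0 \<le> \<alpha> m * \<theta>" using nonneg \<open>0 < \<theta>\<close> by simp
      then show "(a (Suc m))\<^sup>2 \<le> (a m)\<^sup>2" using that by simp
    qed (rule nonneg)
    then show ?case using step k assms(3)[of m] by force
  qed
qed

section \<open>The Ishikawa-type iteration and its rate of convergence\<close>

theorem theorem7p4:
  fixes D :: "'a::banach set"
    and A\<^sub>1 A\<^sub>2 :: "'a \<Rightarrow> 'a set"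
    and q :: 'a
    and \<tau> :: "real \<Rightarrow> real"
    and \<Theta> :: "real \<Rightarrow> real \<Rightarrow> real"
    and \<alpha> \<beta> :: "nat \<Rightarrow> real"
    and \<phi> :: "real \<Rightarrow> nat"
    and r :: "nat \<Rightarrow> real \<Rightarrow> nat"
    and x y u v :: "nat \<Rightarrow> 'a"
    and K\<^sub>0 K\<^sub>1 :: real
  assumes "uniformly_smooth TYPE('a)"
    and "modulus_of_uniform_smoothness TYPE('a) \<tau>"
    and "op_dom A\<^sub>1 = D" and "op_dom A\<^sub>2 = D"
    and "0 \<in> A\<^sub>1 q" and "0 \<in> A\<^sub>2 q"
    and "uniformly_accretive_at_zero A\<^sub>1 q"
    and "uniformly_accretive_at_zero A\<^sub>2 q"
    and "modulus_of_uniform_accretivity_at_zero A\<^sub>1 q \<Theta>"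
    and "\<And>n. 0 \<le> \<alpha> n \<and> \<alpha> n < 1"
    and "\<And>n. 0 \<le> \<beta> n \<and> \<beta> n < 1"
    and "\<alpha> \<longlonglongrightarrow> 0" and "rate_of_convergence \<alpha> \<phi>"
    and "\<beta> \<longlonglongrightarrow> 0" and "rate_of_convergence \<beta> \<phi>"
    and "filterlim (\<lambda>n. \<Sum>i\<le>n. \<alpha> i) at_top sequentially"
    and "rate_of_divergence \<alpha> r"
    and "\<And>n. x n \<in> D" and "\<And>n. y n \<in> D"
    and "\<And>n. x (Suc n) = (1 - \<alpha> n) *\<^sub>R x n + \<alpha> n *\<^sub>R u n"
    and "\<And>n. u n \<in> id_minus A\<^sub>1 (y n)"
    and "\<And>n. y n = (1 - \<beta> n) *\<^sub>R x n + \<beta> n *\<^sub>R v n"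
    and "\<And>n. v n \<in> id_minus A\<^sub>2 (x n)"
    and "K\<^sub>0 > 0" and "K\<^sub>1 > 0"
    and "\<forall>w \<in> op_range (id_minus A\<^sub>1). norm w < K\<^sub>0"
    and "\<forall>w \<in> op_range (id_minus A\<^sub>2). norm w < K\<^sub>0"
    and "norm (x 0 - q) < K\<^sub>1"
  shows "(\<lambda>n. norm (x n - q)) \<longlonglongrightarrow> 0 \<and>
         rate_of_convergence (\<lambda>n. norm (x n - q)) (Phi \<Theta> \<tau> \<phi> r K\<^sub>0 K\<^sub>1)"
proof -
  note step = assms(20) and u = assms(21) and ystep = assms(22) and v = assms(23)
  define K where "K = 2 * K\<^sub>0 + K\<^sub>1"
  have K: "0 < K" "2 * K\<^sub>0 < K" using assms(24,25) by (auto simp: K_def)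
  \<comment> \<open>Since 0 is in \<open>A\<^sub>1 q\<close>, the point \<open>q = q - 0\<close>
    lies in the range of \<open>id_minus A\<^sub>1\<close>.\<close>
  have nq: "norm q < K\<^sub>0"
    using assms(5,26) by (force simp: op_range_def id_minus_def)
  have uq: "norm (u n - q) < 2 * K\<^sub>0" for n
    using u[of n] assms(26) nq norm_triangle_ineq4[of "u n" q] by (force simp: op_range_def)
  have vq: "norm (v n - q) < 2 * K\<^sub>0" for n
    using v[of n] assms(27) nq norm_triangle_ineq4[of "v n" q] by (force simp: op_range_def)
  \<comment> \<open>\<open>K\<close> exceeds both the initial distance and
    \<open>2 * K\<^sub>0\<close>, so convex combinations stay in the open ball of radius
    \<open>K\<close> about \<open>q\<close>.\<close>
  have xq: "norm (x n - q) < K" for n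
  proof (induction n)
    case 0
    show ?case using assms(24,28) by (simp add: K_def)
  next
    case (Suc n)
    have "x (Suc n) - q = (1 - \<alpha> n) *\<^sub>R (x n - q) + \<alpha> n *\<^sub>R (u n - q)"
      by (simp add: step algebra_simps)
    then show ?case using norm_convex_comb_less[of "\<alpha> n" "x n - q" K "u n - q"] Suc uq[of n] K assms(10)[of n]
      by simp
  qed
  have yq: "norm (y n - q) < K" for n
  proof -
    have "y n - q = (1 - \<beta> n) *\<^sub>R (x n - q) + \<beta> n *\<^sub>R (v n - q)"
      by (simp add: ystep algebra_simps)
    then show ?thesis using norm_convex_comb_less[of "\<beta> n" "x n - q" K "v n - q"] xq[of n] vq[of n] K assms(11)[of n]
      by simp
  qed
  have ux: "norm (u n - x n) \<le> 2 * K" and vx: "norm (v n - x n) \<le> 2 * K"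
    and yu: "norm (y n - u n) \<le> 2 * K" for n
    using norm_triangle_ineq4[of "u n - q" "x n - q"] norm_triangle_ineq4[of "v n - q" "x n - q"]
      norm_triangle_ineq4[of "y n - q" "u n - q"] uq[of n] vq[of n] xq[of n] yq[of n] K
    by simp_all
  have acc: "accretive A\<^sub>1" using assms(7) by (simp add: uniformly_accretive_at_zero_def)
  have main: "norm (x n - q) \<le> \<epsilon>" if \<epsilon>: "0 < \<epsilon>" and n: "Phi \<Theta> \<tau> \<phi> r K\<^sub>0 K\<^sub>1 \<epsilon> \<le> n" for \<epsilon> n
  proof -
    define \<theta> where "\<theta> = \<Theta> K (\<epsilon> / 2)"
    have \<theta>: "0 < \<theta>" and unif: "uniform_accretivity_cond A\<^sub>1 q (\<epsilon> / 2) K \<theta>"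
      using assms(9) \<epsilon> K by (auto simp: modulus_of_uniform_accretivity_at_zero_def \<theta>_def)
    \<comment> \<open>The first entry serves the case of \<open>y k\<close> near \<open>q\<close>; a
      third of the second bounds \<open>norm (y k - x k)\<close> by
      \<open>\<theta> / (32 * K)\<close>; the third serves the continuity of the duality
      mapping.\<close>
    define m where "m = min (\<epsilon> / 2) (min (3 * \<theta> / (32 * K)) (omega \<tau> K (\<theta> / (16 * K))))"
    have m: "m \<le> \<epsilon> / 2" "m \<le> 3 * \<theta> / (32 * K)" "m \<le> omega \<tau> K (\<theta> / (16 * K))"
      by (auto simp: m_def)
    have "0 < omega \<tau> K (\<theta> / (16 * K))"
      by (rule omega_pos[OF assms(2)]) (use \<theta> K in simp)
    \<comment> \<open>Needed because \<phi> is constrained only at positive arguments.\<close>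
    then have m0: "0 < m" using \<epsilon> \<theta> K by (simp add: m_def)
    define N where "N = \<phi> (1 / (6 * K) * m)"
    define M where "M = r N (K\<^sup>2 / \<theta>)"
    have Phi: "Phi \<Theta> \<tau> \<phi> r K\<^sub>0 K\<^sub>1 \<epsilon> = M + 1"
      by (simp add: Phi_def Let_def M_def N_def m_def \<theta>_def K_def)
    \<comment> \<open>The factor \<open>1 / (6 * K)\<close> cancels the diameter bound
      \<open>2 * K\<close> and leaves a third of \<open>m\<close> for each of the two
      displacements.\<close>
    have small: "\<alpha> k * (2 * K) \<le> m / 3" "\<beta> k * (2 * K) \<le> m / 3" if "N \<le> k" for k
    proof -
      have "0 < 1 / (6 * K) * m" using K m0 by simp
      then have "\<alpha> k \<le> 1 / (6 * K) * m" "\<beta> k \<le> 1 / (6 * K) * m"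
        using assms(13,15) that unfolding rate_of_convergence_def N_def by blast+
      then show "\<alpha> k * (2 * K) \<le> m / 3" "\<beta> k * (2 * K) \<le> m / 3"
        using K by (simp_all add: field_simps)
    qed
    show ?thesis
    proof (rule descent_rate[where a = "\<lambda>n. norm (x n - q)" and N = N and M = M and K = K
          and \<alpha> = \<alpha> and \<theta> = \<theta>])
      fix k assume k: "N \<le> k"
      have yx: "norm (y k - x k) \<le> m / 3"
      proof -
        have "y k - x k = \<beta> k *\<^sub>R (v k - x k)" by (simp add: ystep algebra_simps)
        then have "norm (y k - x k) = \<beta> k * norm (v k - x k)" using assms(11)[of k] by simp
        also have "\<dots> \<le> \<beta> k * (2 * K)" using vx assms(11)[of k] by (intro mult_left_mono) auto
        finally show ?thesis using small(2)[OF k] by linarith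
      qed
      have xx: "norm (x (Suc k) - x k) \<le> m / 3"
      proof -
        have "x (Suc k) - x k = \<alpha> k *\<^sub>R (u k - x k)" by (simp add: step algebra_simps)
        then have "norm (x (Suc k) - x k) = \<alpha> k * norm (u k - x k)" using assms(10)[of k] by simp
        also have "\<dots> \<le> \<alpha> k * (2 * K)" using ux assms(10)[of k] by (intro mult_left_mono) auto
        finally show ?thesis using small(1)[OF k] by linarith
      qed
      have xy: "norm (x (Suc k) - y k) \<le> m"
        using norm_triangle_ineq4[of "x (Suc k) - x k" "y k - x k"] xx yx m0 by simp
      show "norm (x (Suc k) - q) \<le> \<epsilon> \<or>
        (norm (x (Suc k) - q))\<^sup>2 \<le> (norm (x k - q))\<^sup>2 - \<alpha> k * \<theta>"
      \<comment> \<open>If \<open>y k\<close> is within \<epsilon>/2 of \<open>q\<close>, then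
        \<open>x (Suc k)\<close>, at distance at most \<open>m\<close> from it, is within
        \<epsilon>. Otherwise \<open>norm (y k - q)\<close> lies between \<epsilon>/2 and
        \<open>K\<close>, where uniform accretivity applies.\<close>
      proof (cases "\<epsilon> / 2 \<le> norm (y k - q)")
        case False
        then show ?thesis
          using norm_triangle_ineq[of "x (Suc k) - y k" "y k - q"] xy m(1) by simp
      next
        case True
        obtain a where a: "a \<in> A\<^sub>1 (y k)" "u k = y k - a"
          using u[of k] by (auto simp: id_minus_def)
        obtain l where l: "l \<in> duality_map (y k - q)" "\<theta> \<le> blinfun_apply l a"
          using unif a(1) True yq[of k] unfolding uniform_accretivity_cond_def
          by (meson atLeastAtMost_iff less_imp_le)
        obtain j where j: "j \<in> duality_map (x (Suc k) - q)"
          using accretive_duality_map_nonempty[OF acc assms(5)] assms(3,18) by metis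
        have "(norm (x (Suc k) - q))\<^sup>2 \<le> (norm (x k - q))\<^sup>2 - \<alpha> k * \<theta>"
        proof (rule descent_step[OF assms(2) j l(1) l(2) \<theta> K(1)])
          show "norm (x (Suc k) - q) \<le> K" "norm (y k - q) \<le> K"
            using xq yq by (simp_all add: less_imp_le)
          show "norm a \<le> 2 * K" using yu[of k] a(2) by simp
          show "x (Suc k) - q = x k - q + \<alpha> k *\<^sub>R (y k - q - (x k - q) - a)"
            by (simp add: step a(2) algebra_simps)
          show "0 \<le> \<alpha> k" using assms(10) by simp
          have "m / 3 \<le> \<theta> / (32 * K)" using m(2) by simp
          then show "norm (y k - q - (x k - q)) \<le> \<theta> / (32 * K)" using yx by simp
          show "norm (x (Suc k) - q - (y k - q)) \<le> omega \<tau> K (\<theta> / (16 * K))"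
            using xy m(3) by simp
        qed
        then show ?thesis by simp
      qed
    next
      have "0 < K\<^sup>2 / \<theta>" using K \<theta> by simp
      then show "K\<^sup>2 / \<theta> \<le> (\<Sum>i=N..M. \<alpha> i)"
        using assms(17) unfolding rate_of_divergence_def M_def by blast
      show "norm (x N - q) \<le> K" using xq[of N] by simp
      show "M + 1 \<le> n" using n Phi by simp
    qed (use assms(10) \<epsilon> \<theta> K in auto)
  qed
  have "(\<lambda>n. norm (x n - q)) \<longlonglongrightarrow> 0"
  proof (rule LIMSEQ_I)
    fix e :: real assume "0 < e"
    \<comment> \<open>Halving \<open>e\<close> turns the weak inequality of the rate into the strict
      one of the limit.\<close>
    then have "norm (norm (x n - q) - 0) < e" if "Phi \<Theta> \<tau> \<phi> r K\<^sub>0 K\<^sub>1 (e / 2) \<le> n" for n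
      using main[OF _ that] by simp
    then show "\<exists>n0. \<forall>n\<ge>n0. norm (norm (x n - q) - 0) < e" by blast
  qed
  then show ?thesis using main by (simp add: rate_of_convergence_def)
qed

end
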